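(* Let $A\in\mathbb{R}^{n\times n}$, $B_1^{\rm o}\in\mathbb{R}^{n\times m_1}$, $B_2\in\mathbb{R}^{n\times m_2}$, $C_1^{\rm o}\in\mathbb{R}^{p_1\times n}$, $C_2\in\mathbb{R}^{p_2\times n}$ be (constant) real matrices. Define $$\widetilde B_1=B_2B_2^{\dagger}B_1^{\rm o},\qquad \widetilde C_1=C_1^{\rm o}C_2^{\dagger}C_2,\qquad \gamma^*=\max\{\|B_2^{\dagger}B_1^{\rm o}\|_2,\ \|C_1^{\rm o}C_2^{\dagger}\|_2\}.$$ Suppose that $\gamma^*>0$, that $(A,B_2)$ and $(A,\widetilde B_1)$ are stabilizable, and that $(\widetilde C_1,A)$ and $(C_2,A)$ are detectable. For $\gamma>\gamma^*$ let $X(\gamma)$ and $Y(\gamma)$ be the stabilizing positive-semidefinite solutions of the two Riccati equations specified in the context, let $\rho(\gamma)$ be the spectral radius of $X(\gamma)Y(\gamma)$, and set $$\chi(\gamma)=\gamma^{-2}\rho(\gamma).$$ Then $\chi$ is nonincreasing on $(\gamma^*,\infty)$ and $\chi(\gamma)\to 0$ as $\gamma\to\infty$. Moreover, given $\gamma_l>\gamma^*$, put $\rho_l=\rho(\gamma_l)$; then for every $\tau\in(0,1)$ and $\eta>0$ the value $$\gamma_{l+1}=(1+\eta)\max\left\{\gamma_l,\ \sqrt{\frac{\rho_l}{1-\tau}}\right\}$$ satisfies $\chi(\gamma_{l+1})<1-\tau$.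
   Context: $M^{\dagger}$ denotes the Moore--Penrose inverse and $\|\cdot\|_2$ the spectral norm. A real square matrix is called stable if all its eigenvalues have negative real part. $(A,B)$ is stabilizable if $A+BK$ is stable for some real matrix $K$; $(C,A)$ is detectable if $(A^{\top},C^{\top})$ is stabilizable. For $\gamma>\gamma^*$ set $$G_\gamma=B_2B_2^{\top}-\gamma^{-2}\widetilde B_1\widetilde B_1^{\top},\qquad H_\gamma=C_2^{\top}C_2-\gamma^{-2}\widetilde C_1^{\top}\widetilde C_1 .$$ $X(\gamma)$ denotes the unique symmetric solution of $$A^{\top}X+XA-XG_\gamma X+\widetilde C_1^{\top}\widetilde C_1=0$$ for which $A-G_\gamma X$ is stable, and $Y(\gamma)$ denotes the unique symmetric solution of $$AY+YA^{\top}-YH_\gamma Y+\widetilde B_1\widetilde B_1^{\top}=0$$ for which $A^{\top}-H_\gamma Y$ is stable. Under the stated stabilizability and detectability assumptions and $\gamma>\gamma^*>0$, these solutions exist and are positive semidefinite. *)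

theory Defs
  imports "HOL-Analysis.Analysis"
begin

text \<open>A matrix with \<open>r\<close> rows and \<open>c\<close> columns has type \<open>real ^ 'c ^ 'r\<close>.\<close>

definition moore_penrose :: "real ^ 'c ^ 'r \<Rightarrow> real ^ 'r ^ 'c" where
  "moore_penrose M = (THE P. M ** P ** M = M \<and> P ** M ** P = P \<and>
     transpose (M ** P) = M ** P \<and> transpose (P ** M) = P ** M)"

text \<open>The norm on \<open>real ^ 'n\<close> is the Euclidean one, so this is the largest singular value.\<close>

definition spectral_norm :: "real ^ 'c ^ 'r \<Rightarrow> real" where
  "spectral_norm M = onorm (\<lambda>x. M *v x)"

definition eigenvalues :: "real ^ 'n ^ 'n \<Rightarrow> complex set" where
  "eigenvalues M = {z. \<exists>v. v \<noteq> 0 \<and> map_matrix complex_of_real M *v v = z *s v}"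

text \<open>The set of eigenvalues is finite and nonempty, so the supremum is a maximum.\<close>

definition spectral_radius :: "real ^ 'n ^ 'n \<Rightarrow> real" where
  "spectral_radius M = (SUP z\<in>eigenvalues M. cmod z)"

definition stable :: "real ^ 'n ^ 'n \<Rightarrow> bool" where
  "stable M \<longleftrightarrow> (\<forall>z\<in>eigenvalues M. Re z < 0)"

definition stabilizable :: "real ^ 'n ^ 'n \<Rightarrow> real ^ 'm ^ 'n \<Rightarrow> bool" where
  "stabilizable A B \<longleftrightarrow> (\<exists>K. stable (A + B ** K))"

definition detectable :: "real ^ 'n ^ 'p \<Rightarrow> real ^ 'n ^ 'n \<Rightarrow> bool" where
  "detectable C A \<longleftrightarrow> stabilizable (transpose A) (transpose C)"

definition psd :: "real ^ 'n ^ 'n \<Rightarrow> bool" where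
  "psd M \<longleftrightarrow> transpose M = M \<and> (\<forall>x. 0 \<le> x \<bullet> (M *v x))"

definition stabilizing_riccati_solution ::
  "real ^ 'n ^ 'n \<Rightarrow> real ^ 'n ^ 'n \<Rightarrow> real ^ 'n ^ 'n \<Rightarrow> real ^ 'n ^ 'n \<Rightarrow> bool" where
  "stabilizing_riccati_solution A G Q X \<longleftrightarrow>
     transpose X = X \<and>
     transpose A ** X + X ** A - X ** G ** X + Q = 0 \<and>
     stable (A - G ** X)"

definition B1_tilde :: "real ^ 'm1 ^ 'n \<Rightarrow> real ^ 'm2 ^ 'n \<Rightarrow> real ^ 'm1 ^ 'n" where
  "B1_tilde B1o B2 = B2 ** moore_penrose B2 ** B1o"

definition C1_tilde :: "real ^ 'n ^ 'p1 \<Rightarrow> real ^ 'n ^ 'p2 \<Rightarrow> real ^ 'n ^ 'p1" where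
  "C1_tilde C1o C2 = C1o ** moore_penrose C2 ** C2"

definition gamma_star ::
  "real ^ 'm1 ^ 'n \<Rightarrow> real ^ 'm2 ^ 'n \<Rightarrow> real ^ 'n ^ 'p1 \<Rightarrow> real ^ 'n ^ 'p2 \<Rightarrow> real" where
  "gamma_star B1o B2 C1o C2 =
     max (spectral_norm (moore_penrose B2 ** B1o)) (spectral_norm (C1o ** moore_penrose C2))"

definition G_mat :: "real ^ 'm1 ^ 'n \<Rightarrow> real ^ 'm2 ^ 'n \<Rightarrow> real \<Rightarrow> real ^ 'n ^ 'n" where
  "G_mat B1o B2 \<gamma> = B2 ** transpose B2
     - (1 / \<gamma>\<^sup>2) *\<^sub>R (B1_tilde B1o B2 ** transpose (B1_tilde B1o B2))"

definition H_mat :: "real ^ 'n ^ 'p1 \<Rightarrow> real ^ 'n ^ 'p2 \<Rightarrow> real \<Rightarrow> real ^ 'n ^ 'n" where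
  "H_mat C1o C2 \<gamma> = transpose C2 ** C2
     - (1 / \<gamma>\<^sup>2) *\<^sub>R (transpose (C1_tilde C1o C2) ** C1_tilde C1o C2)"

definition rho :: "(real \<Rightarrow> real ^ 'n ^ 'n) \<Rightarrow> (real \<Rightarrow> real ^ 'n ^ 'n) \<Rightarrow> real \<Rightarrow> real" where
  "rho X Y \<gamma> = spectral_radius (X \<gamma> ** Y \<gamma>)"

definition chi :: "(real \<Rightarrow> real ^ 'n ^ 'n) \<Rightarrow> (real \<Rightarrow> real ^ 'n ^ 'n) \<Rightarrow> real \<Rightarrow> real" where
  "chi X Y \<gamma> = rho X Y \<gamma> / \<gamma>\<^sup>2"

end

theory Submission
  imports Defs "HOL-Computational_Algebra.Fundamental_Theorem_Algebra"
begin

text \<open>Two order-theoretic facts drive the result. A stabilizing solution \<open>X\<close> of the Riccati equation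
  \<open>A\<^sup>T X + X A - X G X + Q = 0\<close> decreases in the Loewner order when \<open>G \<ge> 0\<close> increases
  (\<open>riccati_antimono\<close>), and the spectral radius of a product of two positive semidefinite matrices
  increases with each factor (\<open>spectral_radius_psd_product_mono\<close>).

  They apply because \<open>B1_tilde\<close> factors as \<open>B\<^sub>2 W\<close> with \<open>W = B\<^sub>2\<^sup>\<dagger> B\<^sub>1\<^sup>o\<close>, so that
  \<open>G = B\<^sub>2 (1 - \<gamma>\<^sup>-\<^sup>2 W W\<^sup>T) B\<^sub>2\<^sup>T\<close>. This matrix increases with \<open>\<gamma>\<close>, and it is positive semidefinite as soon
  as \<open>\<gamma>\<close> exceeds the spectral norm of \<open>W\<close>, which is what the threshold \<open>\<gamma>\<^sup>*\<close> ensures; the other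
  equation is the same with \<open>C\<^sub>2\<^sup>T\<close> in place of \<open>B\<^sub>2\<close>. Hence \<open>X\<close>, \<open>Y\<close> and \<open>\<rho>\<close> are nonincreasing above
  the threshold. Dividing the nonincreasing, nonnegative \<open>\<rho>\<close> by \<open>\<gamma>\<^sup>2\<close> gives the first two claims, and the
  third follows from \<open>\<rho>(\<gamma>\<^bsub>l+1\<^esub>) \<le> \<rho>\<^sub>l < (1 - \<tau>) \<gamma>\<^bsub>l+1\<^esub>\<^sup>2\<close>.

  Monotonicity in the Riccati equation rests on the Lyapunov fact \<open>lyapunov_nonneg\<close>: if \<open>A\<close> is stable
  and \<open>A\<^sup>T D + D A \<le> 0\<close>, then \<open>D \<ge> 0\<close>. It is reduced by the Cayley transform to the geometric decay of
  the powers of a matrix with all eigenvalues in the open unit disc (\<open>power_decays\<close>). Monotonicity of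
  the spectral radius of \<open>P S\<close> comes from its description as the least \<open>t \<ge> 0\<close> with \<open>S P S \<le> t S\<close>
  (\<open>spectral_radius_psd_product\<close>).\<close>

section \<open>Powers of a complex matrix with eigenvalues in the open unit disc\<close>

definition poly_action :: "complex poly \<Rightarrow> complex ^ 'n ^ 'n \<Rightarrow> complex ^ 'n \<Rightarrow> complex ^ 'n" where
  "poly_action p M v = (\<Sum>i\<le>degree p. coeff p i *s (((*v) M ^^ i) v))"

lemma poly_action_eq:
  assumes "degree p \<le> N"
  shows "poly_action p M v = (\<Sum>i\<le>N. coeff p i *s (((*v) M ^^ i) v))"
  unfolding poly_action_def
  by (rule sum.mono_neutral_left) (use assms in \<open>auto simp: coeff_eq_0\<close>)

lemma funpow_matrix_diff:
  fixes M :: "complex ^ 'n ^ 'n"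
  shows "((*v) M ^^ k) (u - w) = ((*v) M ^^ k) u - ((*v) M ^^ k) w"
  by (induction k) (auto simp: matrix_vector_mult_diff_distrib)

lemma funpow_matrix_scale:
  fixes M :: "complex ^ 'n ^ 'n"
  shows "((*v) M ^^ k) (c *s w) = c *s ((*v) M ^^ k) w"
  by (induction k) (auto simp: vec.scale)

lemma poly_action_linear_factor:
  "poly_action ([:- z, 1:] * q) M v = poly_action q M (M *v v - z *s v)"
proof -
  let ?f = "\<lambda>i. ((*v) M ^^ i) v"
  have "poly_action ([:- z, 1:] * q) M v
      = (\<Sum>i\<le>Suc (degree q). coeff ([:- z, 1:] * q) i *s ?f i)"
    by (rule poly_action_eq) (use degree_mult_le[of "[:- z, 1:]" q] in simp)
  also have "\<dots> = (\<Sum>i\<le>Suc (degree q). coeff (pCons 0 q) i *s ?f i)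
                - (\<Sum>i\<le>Suc (degree q). (z * coeff q i) *s ?f i)"
  proof -
    have "coeff ([:- z, 1:] * q) i = coeff (pCons 0 q) i - z * coeff q i" for i by simp
    then show ?thesis by (simp only: vec.scale_left_diff_distrib sum_subtractf)
  qed
  also have "(\<Sum>i\<le>Suc (degree q). coeff (pCons 0 q) i *s ?f i)
      = (\<Sum>i\<le>degree q. coeff q i *s ((*v) M ^^ i) (M *v v))"
    by (subst sum.atMost_Suc_shift) (simp add: funpow_swap1)
  also have "(\<Sum>i\<le>Suc (degree q). (z * coeff q i) *s ?f i)
      = (\<Sum>i\<le>degree q. coeff q i *s ((*v) M ^^ i) (z *s v))"
    by (simp add: coeff_eq_0 funpow_matrix_scale mult.commute)
  finally show ?thesis
    by (simp only: poly_action_def funpow_matrix_diff sum_subtractf vec.scale_right_diff_distrib)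
qed

text \<open>The vectors \<open>v, M v, M\<^sup>2 v, \<dots>\<close> up to the real dimension of \<open>complex ^ 'n\<close> are one too many to
  be independent. Real coefficients are enough for this, but the polynomial is taken over the
  complex numbers so that it splits into linear factors.\<close>

lemma annihilating_polynomial:
  fixes M :: "complex ^ 'n ^ 'n"
  obtains p where "p \<noteq> 0" and "poly_action p M v = 0"
proof -
  define f where "f i = ((*v) M ^^ i) v" for i
  define N where "N = DIM(complex ^ 'n)"
  \<comment> \<open>Dependence is a property of sets, so a repetition among the iterates needs its own relation.\<close>
  have "\<exists>c::nat \<Rightarrow> complex. (\<exists>i\<le>N. c i \<noteq> 0) \<and> (\<Sum>i\<le>N. c i *s f i) = 0"
  proof (cases "inj_on f {..N}")
    case True
    have "card (f ` {..N}) = Suc N" by (simp add: card_image[OF True])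
    then have "dependent (f ` {..N})"
      by (intro dependent_biggerset) (simp only: N_def[symmetric] lessI)
    then obtain u w where u: "w \<in> f ` {..N}" "u w \<noteq> 0" "(\<Sum>x\<in>f ` {..N}. u x *\<^sub>R x) = 0"
      by (subst (asm) real_vector.dependent_finite) auto
    have "u x *\<^sub>R y = complex_of_real (u x) *s y" for x y :: "complex ^ 'n"
      by (simp add: vec_eq_iff) (simp add: scaleR_conv_of_real)
    then have "(\<Sum>i\<le>N. complex_of_real (u (f i)) *s f i) = 0"
      using u(3) by (simp add: sum.reindex[OF True])
    then show ?thesis
      using u(1,2) by (intro exI[of _ "\<lambda>i. complex_of_real (u (f i))"]) auto
  next
    case False
    then obtain i j where ij: "i \<le> N" "j \<le> N" "i \<noteq> j" "f i = f j"
      by (auto simp: inj_on_def)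
    have "(\<Sum>k\<le>N. ((if k = i then 1 else 0) - (if k = j then 1 else 0)) *s f k) = f i - f j"
      using ij(1,2)
      by (simp add: vec.scale_left_diff_distrib sum_subtractf if_distrib[of "\<lambda>c. c *s _"] cong: if_cong)
    then show ?thesis
      using ij by (intro exI[of _ "\<lambda>k. (if k = i then 1 else 0) - (if k = j then 1 else 0)"]) auto
  qed
  then obtain c :: "nat \<Rightarrow> complex" and j
    where c: "j \<le> N" "c j \<noteq> 0" "(\<Sum>i\<le>N. c i *s f i) = 0" by blast
  define p where "p = (\<Sum>i\<le>N. monom (c i) i)"
  have coeff_p: "coeff p i = (if i \<le> N then c i else 0)" for i
    by (simp add: p_def coeff_sum coeff_monom)
  have "p \<noteq> 0"
    using c(1,2) coeff_p[of j] by auto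
  moreover have "degree p \<le> N"
    by (rule degree_le) (simp add: coeff_p)
  then have "poly_action p M v = 0"
    using c(3) by (simp add: poly_action_eq f_def) (simp add: coeff_p)
  ultimately show ?thesis by (rule that)
qed

definition decays_geometrically :: "complex ^ 'n ^ 'n \<Rightarrow> complex ^ 'n \<Rightarrow> bool" where
  "decays_geometrically M v \<longleftrightarrow> (\<exists>C r. 0 \<le> r \<and> r < 1 \<and> (\<forall>k. norm (((*v) M ^^ k) v) \<le> C * r ^ k))"

lemma norm_cscale: "norm (z *s (w :: complex ^ 'n)) = cmod z * norm w"
  by (simp add: norm_vec_def L2_set_def norm_mult power_mult_distrib sum_distrib_left[symmetric]
      real_sqrt_mult)

text \<open>The iterates satisfy \<open>x\<^bsub>k+1\<^esub> = z x\<^bsub>k\<^esub> + e\<^bsub>k\<^esub>\<close> with \<open>\<bar>z\<bar> < 1\<close> and a geometrically small forcing term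
  \<open>e\<^bsub>k\<^esub> = M\<^sup>k (M v - z v)\<close>, so they decay at any rate slower than both.\<close>

lemma decays_of_small_eigenvalue:
  fixes M :: "complex ^ 'n ^ 'n"
  assumes "cmod z < 1" and "decays_geometrically M (M *v v - z *s v)"
  shows "decays_geometrically M v"
proof -
  obtain C s where s: "0 \<le> s" "s < 1"
    and C: "\<And>k. norm (((*v) M ^^ k) (M *v v - z *s v)) \<le> C * s ^ k"
    using assms(2) unfolding decays_geometrically_def by blast
  have "0 \<le> C" using C[of 0] norm_ge_zero[of "M *v v - z *s v"] by (simp del: norm_ge_zero)
  \<comment> \<open>Room between \<open>\<bar>z\<bar>\<close> and \<open>r\<close> is what lets \<open>K\<close> absorb the forcing term.\<close>
  obtain r where r: "max (cmod z) s < r" "r < 1"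
    using assms(1) s(2) dense[of "max (cmod z) s" 1] by auto
  then have r0: "0 < r" using s(1) by auto
  define K where "K = norm v + C / (r - cmod z)"
  have "(r - cmod z) * K = (r - cmod z) * norm v + C"
    using r(1) by (simp add: K_def field_simps)
  then have K: "C \<le> (r - cmod z) * K" "norm v \<le> K"
    using r(1) \<open>0 \<le> C\<close> by (auto simp: K_def)
  have "norm (((*v) M ^^ k) v) \<le> K * r ^ k" for k
  proof (induction k)
    case 0
    then show ?case using K by simp
  next
    case (Suc k)
    let ?x = "((*v) M ^^ k) v"
    have "((*v) M ^^ Suc k) v = z *s ?x + ((*v) M ^^ k) (M *v v - z *s v)"
      by (simp add: funpow_matrix_diff funpow_matrix_scale funpow_swap1)
    then have "norm (((*v) M ^^ Suc k) v) \<le> cmod z * norm ?x + C * s ^ k"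
      by (metis norm_triangle_le norm_cscale C add_left_mono)
    also have "\<dots> \<le> cmod z * (K * r ^ k) + C * r ^ k"
      using Suc r(1) s(1) \<open>0 \<le> C\<close> by (intro add_mono mult_left_mono power_mono) auto
    also have "\<dots> = (cmod z * K + C) * r ^ k" by (simp add: algebra_simps)
    also have "\<dots> \<le> (r * K) * r ^ k"
      using K(1) r0 by (intro mult_right_mono) (auto simp: algebra_simps)
    finally show ?case by (simp add: algebra_simps)
  qed
  then show ?thesis unfolding decays_geometrically_def using r0 r(2) by (intro exI[of _ K] exI[of _ r]) auto
qed

text \<open>When \<open>z\<close> is not an eigenvalue, \<open>M - z\<close> has an inverse, which commutes with \<open>M\<close> and therefore carries
  the decay of the iterates of \<open>(M - z) v\<close> back to those of \<open>v\<close> at the cost of a constant.\<close>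

lemma decays_of_non_eigenvalue:
  fixes M :: "complex ^ 'n ^ 'n"
  assumes "\<And>w. M *v w = z *s w \<Longrightarrow> w = 0" and "decays_geometrically M (M *v v - z *s v)"
  shows "decays_geometrically M v"
proof -
  define N where "N = M - mat z"
  have Nv: "N *v w = M *v w - z *s w" for w
  proof -
    have "mat z *v w = z *s w"
      by (simp add: matrix_vector_mult_def mat_def vec_eq_iff if_distrib if_distribR cong: if_cong)
    then show ?thesis by (simp add: N_def matrix_vector_mult_diff_rdistrib)
  qed
  have "N *v w = 0 \<Longrightarrow> w = 0" for w using assms(1) by (auto simp: Nv)
  then obtain R where R: "R ** N = mat 1" using matrix_left_invertible_ker[of N] by blast
  then have R': "N ** R = mat 1" by (simp add: matrix_left_right_inverse)
  have comm: "M *v (N *v w) = N *v (M *v w)" for w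
    by (simp add: Nv matrix_vector_mult_diff_distrib vec.scale)
  have RM: "R *v (M *v w) = M *v (R *v w)" for w
  proof -
    have "N *v (M *v (R *v w)) = M *v (N *v (R *v w))"
      by (rule comm[symmetric])
    also have "\<dots> = M *v w"
      by (simp add: matrix_vector_mul_assoc[of N R] R')
    finally have "N *v (M *v (R *v w)) = M *v w" .
    then have "R *v (N *v (M *v (R *v w))) = R *v (M *v w)" by simp
    then show ?thesis by (simp add: matrix_vector_mul_assoc[of R N] R)
  qed
  have pow: "R *v (((*v) M ^^ k) w) = ((*v) M ^^ k) (R *v w)" for k w
    by (induction k) (auto simp: RM)
  obtain C s where s: "0 \<le> s" "s < 1"
    and C: "\<And>k. norm (((*v) M ^^ k) (M *v v - z *s v)) \<le> C * s ^ k"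
    using assms(2) unfolding decays_geometrically_def by blast
  have "bounded_linear ((*v) R)" by (simp add: linear_linear)
  then obtain B where B: "0 < B" "\<And>w. norm (R *v w) \<le> norm w * B"
    using bounded_linear.pos_bounded by blast
  have "norm (((*v) M ^^ k) v) \<le> (C * B) * s ^ k" for k
  proof -
    have "((*v) M ^^ k) v = R *v (((*v) M ^^ k) (M *v v - z *s v))"
      by (simp add: pow Nv[symmetric] matrix_vector_mul_assoc R)
    then have "norm (((*v) M ^^ k) v) \<le> norm (((*v) M ^^ k) (M *v v - z *s v)) * B"
      using B by simp
    also have "\<dots> \<le> C * s ^ k * B" using C B by (intro mult_right_mono) auto
    finally show ?thesis by (simp add: algebra_simps)
  qed
  then show ?thesis unfolding decays_geometrically_def using s by (intro exI[of _ "C * B"] exI[of _ s]) auto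
qed

text \<open>Peeling the linear factors off an annihilating polynomial of \<open>v\<close> one at a time leaves a vector
  annihilated by a constant, that is, zero. Each factor peeled off preserves decay in the backward
  direction, whether or not its root is an eigenvalue.\<close>

lemma power_decays:
  fixes M :: "complex ^ 'n ^ 'n"
  assumes eig: "\<And>z w. w \<noteq> 0 \<Longrightarrow> M *v w = z *s w \<Longrightarrow> cmod z < 1"
  shows "decays_geometrically M v"
proof -
  have "p \<noteq> 0 \<Longrightarrow> poly_action p M v = 0 \<Longrightarrow> decays_geometrically M v" for p v
  proof (induction "degree p" arbitrary: p v)
    case 0
    then obtain a where "p = [:a:]" "a \<noteq> 0" by (metis degree_eq_zeroE pCons_eq_0_iff)
    with 0 have "v = 0" by (simp add: poly_action_def)
    moreover have "((*v) M ^^ k) (0 :: complex ^ 'n) = 0" for k by (induction k) auto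
    ultimately show ?case unfolding decays_geometrically_def by (intro exI[of _ 0]) auto
  next
    case (Suc n)
    obtain z where "poly p z = 0"
      using fundamental_theorem_of_algebra_alt[of p] Suc.hyps(2) by fastforce
    then obtain q where q: "p = [:- z, 1:] * q" by (auto simp: poly_eq_0_iff_dvd elim: dvdE)
    with Suc.prems(1) have "q \<noteq> 0" by auto
    then have "degree p = Suc (degree q)" unfolding q by (subst degree_mult_eq) auto
    then have "n = degree q" using Suc.hyps(2) by simp
    moreover have "poly_action q M (M *v v - z *s v) = 0"
      using Suc.prems(2) by (simp only: q poly_action_linear_factor)
    ultimately have "decays_geometrically M (M *v v - z *s v)" using Suc.hyps(1) \<open>q \<noteq> 0\<close> by blast
    then show ?case
      using eig decays_of_small_eigenvalue decays_of_non_eigenvalue by blast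
  qed
  then show ?thesis using annihilating_polynomial by metis
qed

section \<open>Lyapunov inequality for stable matrices\<close>

definition cvec :: "real ^ 'n \<Rightarrow> complex ^ 'n" where
  "cvec x = (\<chi> i. complex_of_real (x $ i))"

abbreviation cmat :: "real ^ 'c ^ 'r \<Rightarrow> complex ^ 'c ^ 'r" where
  "cmat \<equiv> map_matrix complex_of_real"

lemma cmat_mult: "cmat (M ** N) = cmat M ** cmat N"
  by (simp add: vec_eq_iff matrix_matrix_mult_def)

lemma cmat_cvec: "cmat M *v cvec x = cvec (M *v x)"
  by (simp add: vec_eq_iff matrix_vector_mult_def cvec_def)

lemma cmat_1: "cmat (mat 1) = mat 1"
  by (simp add: vec_eq_iff mat_def)

lemma norm_cvec: "norm (cvec x) = norm x"
  by (simp add: norm_vec_def cvec_def)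

lemma cvec_eq_0_iff: "cvec x = 0 \<longleftrightarrow> x = 0"
  by (simp add: vec_eq_iff cvec_def)

lemma real_eigenvector:
  assumes "M *v x = r *\<^sub>R x" "x \<noteq> 0"
  shows "complex_of_real r \<in> eigenvalues M"
proof -
  have "cmat M *v cvec x = complex_of_real r *s cvec x"
    unfolding cmat_cvec assms(1) by (simp add: vec_eq_iff cvec_def)
  then show ?thesis
    using assms(2) cvec_eq_0_iff unfolding eigenvalues_def by blast
qed

lemma inner_transpose: "x \<bullet> (transpose M *v y) = (M *v x) \<bullet> y" for M :: "real ^ 'c ^ 'r"
  by (metis dot_lmul_matrix inner_commute transpose_matrix_vector)

text \<open>An eigenvalue \<open>\<mu>\<close> of the Cayley transform \<open>(1 + A) (1 - A)\<^sup>-\<^sup>1\<close> belongs to the eigenvalue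
  \<open>(\<mu> - 1) / (\<mu> + 1)\<close> of \<open>A\<close>, and this Moebius map sends the exterior of the open unit disc to the
  closed right half-plane.\<close>

lemma cayley_eigenvalue_bound:
  fixes A :: "complex ^ 'n ^ 'n"
  assumes stab: "\<And>z y. y \<noteq> 0 \<Longrightarrow> A *v y = z *s y \<Longrightarrow> Re z < 0"
    and "y \<noteq> 0" and eq: "y + A *v y = \<mu> *s (y - A *v y)"
  shows "cmod \<mu> < 1"
proof -
  have Ay: "(\<mu> + 1) * (A *v y) $ i = (\<mu> - 1) * y $ i" for i
    using arg_cong[OF eq, of "\<lambda>v. v $ i"] by (simp add: algebra_simps)
  have "\<mu> + 1 \<noteq> 0"
  proof
    assume \<mu>: "\<mu> + 1 = 0"
    then have "\<mu> = -1" by (simp add: eq_neg_iff_add_eq_0)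
    then have "y = 0" using Ay \<mu> by (simp add: vec_eq_iff)
    with \<open>y \<noteq> 0\<close> show False by simp
  qed
  then have "A *v y = ((\<mu> - 1) / (\<mu> + 1)) *s y"
    using Ay by (simp add: vec_eq_iff field_simps)
  then have "Re ((\<mu> - 1) / (\<mu> + 1)) < 0"
    using stab \<open>y \<noteq> 0\<close> by blast
  moreover have "(Re (\<mu> + 1))\<^sup>2 + (Im (\<mu> + 1))\<^sup>2 > 0"
    using \<open>\<mu> + 1 \<noteq> 0\<close> by (metis complex_neq_0)
  ultimately have "Re (\<mu> - 1) * Re (\<mu> + 1) + Im (\<mu> - 1) * Im (\<mu> + 1) < 0"
    unfolding Re_divide by (simp add: divide_less_0_iff)
  then have "(Re \<mu>)\<^sup>2 + (Im \<mu>)\<^sup>2 < 1"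
    by (simp add: algebra_simps power2_eq_square)
  then have "(cmod \<mu>)\<^sup>2 < 1" by (simp only: cmod_power2)
  then show ?thesis by (simp add: power_less_one_iff abs_square_less_1)
qed

text \<open>The standard argument follows the quadratic form of \<open>D\<close> along the flow of \<open>A\<close>, where it decreases to
  its value at the origin. The Cayley transform \<open>F = (1 + A) (1 - A)\<^sup>-\<^sup>1\<close> is a discrete substitute for
  the flow: with \<open>u = (1 - A) y\<close> and \<open>F u = (1 + A) y\<close>, the quadratic terms in \<open>A y\<close>
  cancel in the increment of the form, which is exactly twice the Lyapunov expression at \<open>y\<close>.\<close>

lemma lyapunov_nonneg:
  fixes A D :: "real ^ 'n ^ 'n"
  assumes "stable A"
    and lyap: "\<And>x. (A *v x) \<bullet> (D *v x) + x \<bullet> (D *v (A *v x)) \<le> 0"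
  shows "0 \<le> x \<bullet> (D *v x)"
proof -
  define N where "N = mat 1 - A"
  have stab: "Re z < 0" if "w \<noteq> 0" "cmat A *v w = z *s w" for z w
    using that assms(1) unfolding stable_def eigenvalues_def by blast
  \<comment> \<open>Since \<open>1\<close> is not an eigenvalue of \<open>A\<close>, the Cayley transform exists.\<close>
  have "y = 0" if "N *v y = 0" for y
  proof (rule ccontr)
    assume "y \<noteq> 0"
    have "A *v y = 1 *\<^sub>R y"
      using that by (simp add: N_def matrix_vector_mult_diff_rdistrib)
    from real_eigenvector[OF this \<open>y \<noteq> 0\<close>] assms(1) show False
      unfolding stable_def by force
  qed
  then obtain J where "J ** N = mat 1" using matrix_left_invertible_ker[of N] by blast
  then have NJ: "N ** J = mat 1" by (simp add: matrix_left_right_inverse)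
  define F where "F = (mat 1 + A) ** J"
  have split: "u = J *v u - A *v (J *v u)" "F *v u = J *v u + A *v (J *v u)" for u
  proof -
    have "u = N *v (J *v u)" by (simp only: matrix_vector_mul_assoc NJ matrix_vector_mul_lid)
    then show "u = J *v u - A *v (J *v u)"
      by (simp add: N_def matrix_vector_mult_diff_rdistrib)
    show "F *v u = J *v u + A *v (J *v u)"
      by (simp add: F_def matrix_vector_mul_assoc[symmetric] matrix_vector_mult_add_rdistrib)
  qed
  have decrease: "(F *v u) \<bullet> (D *v (F *v u)) \<le> u \<bullet> (D *v u)" for u
  proof -
    define y where "y = J *v u"
    have u: "u = y - A *v y" and Fu: "F *v u = y + A *v y"
      using split[of u] by (simp_all add: y_def)
    have "(y + A *v y) \<bullet> (D *v (y + A *v y)) - (y - A *v y) \<bullet> (D *v (y - A *v y))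
        = 2 * ((A *v y) \<bullet> (D *v y) + y \<bullet> (D *v (A *v y)))"
      by (simp add: matrix_vector_mult_diff_distrib matrix_vector_right_distrib inner_diff_left
          inner_diff_right inner_add_left inner_add_right)
    then show ?thesis unfolding Fu using lyap[of y] by (simp add: u[symmetric])
  qed
  have pow_le: "((*v) F ^^ k) x \<bullet> (D *v ((*v) F ^^ k) x) \<le> x \<bullet> (D *v x)" for k
    by (induction k) (auto intro: order_trans[OF decrease])
  have "cmod \<mu> < 1" if "w \<noteq> 0" "cmat F *v w = \<mu> *s w" for \<mu> w
  proof -
    define y where "y = cmat J *v w"
    have "cmat N = mat 1 - cmat A" and "cmat (mat 1 + A) = mat 1 + cmat A"
      by (simp_all add: N_def vec_eq_iff mat_def)
    moreover have "cmat N *v y = w"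
      by (simp only: y_def matrix_vector_mul_assoc cmat_mult[symmetric] NJ cmat_1 matrix_vector_mul_lid)
    moreover have "cmat F *v w = cmat (mat 1 + A) *v y"
      by (simp only: F_def cmat_mult y_def matrix_vector_mul_assoc)
    ultimately have w: "w = y - cmat A *v y" and Fw: "cmat F *v w = y + cmat A *v y"
      by (simp_all add: matrix_vector_mult_diff_rdistrib matrix_vector_mult_add_rdistrib)
    have "y \<noteq> 0" using w \<open>w \<noteq> 0\<close> by auto
    moreover have "y + cmat A *v y = \<mu> *s (y - cmat A *v y)"
      using that(2) Fw w by simp
    ultimately show ?thesis
      using cayley_eigenvalue_bound[of "cmat A" y \<mu>] stab by blast
  qed
  then have "decays_geometrically (cmat F) (cvec x)" by (rule power_decays)
  then obtain C r where r: "0 \<le> r" "r < 1"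
    and C: "\<And>k. norm (((*v) (cmat F) ^^ k) (cvec x)) \<le> C * r ^ k"
    unfolding decays_geometrically_def by blast
  have "((*v) (cmat F) ^^ k) (cvec x) = cvec (((*v) F ^^ k) x)" for k
    by (induction k) (simp_all add: cmat_cvec)
  then have C': "norm (((*v) F ^^ k) x) \<le> C * r ^ k" for k
    using C[of k] by (simp add: norm_cvec)
  have "(\<lambda>k. C * r ^ k) \<longlonglongrightarrow> 0"
    using r by (intro tendsto_mult_right_zero LIMSEQ_power_zero) auto
  then have lim: "(\<lambda>k. ((*v) F ^^ k) x) \<longlonglongrightarrow> 0"
    by (rule Lim_null_comparison[rotated]) (simp add: C' always_eventually)
  have "(\<lambda>k. ((*v) F ^^ k) x \<bullet> (D *v ((*v) F ^^ k) x)) \<longlonglongrightarrow> 0 \<bullet> (D *v 0)"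
    by (intro tendsto_inner lim bounded_linear.tendsto[OF matrix_vector_mul_bounded_linear])
  then show ?thesis
    using pow_le by (intro LIMSEQ_le_const2) auto
qed

section \<open>Monotonicity of stabilizing Riccati solutions\<close>

lemma transpose_diff: "transpose (M - N) = transpose M - transpose N"
  by (simp add: transpose_def vec_eq_iff)

lemma symmetric_inner:
  fixes S :: "real ^ 'n ^ 'n"
  assumes "transpose S = S"
  shows "x \<bullet> (S *v y) = (S *v x) \<bullet> y"
  using inner_transpose[of x S y] assms by simp

lemma riccati_quadratic_form:
  assumes "stabilizing_riccati_solution A G Q X"
  shows "2 * ((X *v x) \<bullet> (A *v x)) - (X *v x) \<bullet> (G *v (X *v x)) + x \<bullet> (Q *v x) = 0"
proof -
  have sym: "transpose X = X" and eq: "transpose A ** X + X ** A - X ** G ** X + Q = 0"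
    using assms by (auto simp: stabilizing_riccati_solution_def)
  have "x \<bullet> ((transpose A ** X + X ** A - X ** G ** X + Q) *v x) = 0"
    unfolding eq by simp
  then have "x \<bullet> (transpose A *v (X *v x)) + x \<bullet> (X *v (A *v x))
      - x \<bullet> (X *v (G *v (X *v x))) + x \<bullet> (Q *v x) = 0"
    by (simp only: matrix_vector_mult_add_rdistrib matrix_vector_mult_diff_rdistrib
        matrix_vector_mul_assoc[symmetric] inner_add_right inner_diff_right)
  moreover have "x \<bullet> (transpose A *v (X *v x)) = (X *v x) \<bullet> (A *v x)"
    by (simp only: inner_transpose inner_commute)
  ultimately show ?thesis by (simp only: symmetric_inner[OF sym])
qed

text \<open>Subtracting the two equations and writing the result with the closed-loop matrix
  \<open>A\<^sub>1 = A - G\<^sub>1 X\<^sub>1\<close> of the smaller coefficient gives, for \<open>D = X\<^sub>1 - X\<^sub>2\<close>,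
  \<open>A\<^sub>1\<^sup>T D + D A\<^sub>1 = - D G\<^sub>1 D - X\<^sub>2 (G\<^sub>2 - G\<^sub>1) X\<^sub>2\<close>. The right-hand side is negative semidefinite
  because \<open>0 \<le> G\<^sub>1 \<le> G\<^sub>2\<close>, so stability of \<open>A\<^sub>1\<close> makes \<open>D\<close> positive semidefinite.\<close>

lemma riccati_antimono:
  assumes X1: "stabilizing_riccati_solution A G1 Q X1"
    and X2: "stabilizing_riccati_solution A G2 Q X2"
    and sym: "transpose G1 = G1"
    and nonneg: "\<And>x. 0 \<le> x \<bullet> (G1 *v x)"
    and le: "\<And>x. x \<bullet> (G1 *v x) \<le> x \<bullet> (G2 *v x)"
  shows "x \<bullet> (X2 *v x) \<le> x \<bullet> (X1 *v x)"
proof -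
  have "stable (A - G1 ** X1)" and s1: "transpose X1 = X1" and s2: "transpose X2 = X2"
    using X1 X2 by (auto simp: stabilizing_riccati_solution_def)
  then have "0 \<le> x \<bullet> ((X1 - X2) *v x)"
  proof (rule_tac lyapunov_nonneg)
    fix x
    let ?A = "A - G1 ** X1" and ?D = "X1 - X2"
    define a b where "a = X1 *v x" and "b = X2 *v x"
    have D: "?D *v x = a - b" by (simp add: a_def b_def matrix_vector_mult_diff_rdistrib)
    have Ax: "?A *v x = A *v x - G1 *v a"
      by (simp add: a_def matrix_vector_mult_diff_rdistrib matrix_vector_mul_assoc)
    have "x \<bullet> (?D *v y) = (a - b) \<bullet> y" for y
      by (simp add: matrix_vector_mult_diff_rdistrib inner_diff_right inner_diff_left a_def b_def
          symmetric_inner s1 s2)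
    then have "(?A *v x) \<bullet> (?D *v x) + x \<bullet> (?D *v (?A *v x))
        = 2 * ((a - b) \<bullet> (A *v x)) - 2 * ((a - b) \<bullet> (G1 *v a))"
      unfolding Ax D by (simp add: inner_diff_right inner_commute)
    also have "2 * ((a - b) \<bullet> (A *v x)) = a \<bullet> (G1 *v a) - b \<bullet> (G2 *v b)"
      using riccati_quadratic_form[OF X1, of x] riccati_quadratic_form[OF X2, of x]
      by (simp add: a_def b_def inner_diff_left)
    also have "a \<bullet> (G1 *v a) - b \<bullet> (G2 *v b) - 2 * ((a - b) \<bullet> (G1 *v a))
        = - ((a - b) \<bullet> (G1 *v (a - b))) - (b \<bullet> (G2 *v b) - b \<bullet> (G1 *v b))"
      using symmetric_inner[OF sym, of a b]
      by (simp add: matrix_vector_mult_diff_distrib inner_diff_left inner_diff_right inner_commute)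
    also have "\<dots> \<le> 0" using nonneg[of "a - b"] le[of b] by simp
    finally show "(?A *v x) \<bullet> (?D *v x) + x \<bullet> (?D *v (?A *v x)) \<le> 0" .
  qed
  then show ?thesis by (simp add: matrix_vector_mult_diff_rdistrib inner_diff_right)
qed

section \<open>Spectral radius of a product of positive semidefinite matrices\<close>

text \<open>If \<open>w = S x\<close> were nonzero, moving from \<open>x\<close> a little in the direction \<open>- w\<close> would make the form
  negative.\<close>

lemma psd_kernel:
  assumes "psd S" "x \<bullet> (S *v x) = 0"
  shows "S *v x = 0"
proof (rule ccontr)
  define w where "w = S *v x"
  assume "S *v x \<noteq> 0"
  then have w: "0 < w \<bullet> w" by (simp add: w_def)
  have sym: "transpose S = S" and nonneg: "\<And>y. 0 \<le> y \<bullet> (S *v y)"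
    using assms(1) by (auto simp: psd_def)
  define c where "c = w \<bullet> (S *v w)"
  have "0 \<le> c" using nonneg by (simp add: c_def)
  \<comment> \<open>Any \<open>t > 0\<close> with \<open>t c < 2 (w \<bullet> w)\<close> would do; the \<open>1\<close> covers the case \<open>c = 0\<close>.\<close>
  define t where "t = (w \<bullet> w) / (1 + c)"
  have t: "0 < t" "t * c < w \<bullet> w"
    using w \<open>0 \<le> c\<close> by (auto simp: t_def field_simps)
  have "(x - t *\<^sub>R w) \<bullet> (S *v (x - t *\<^sub>R w)) = t * (t * c - 2 * (w \<bullet> w))"
    using assms(2) symmetric_inner[OF sym, of x w]
    by (simp add: matrix_vector_mult_diff_distrib inner_diff_left inner_diff_right
        matrix_vector_mult_scaleR w_def[symmetric] c_def algebra_simps)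
  also have "\<dots> < 0" using t w by (intro mult_pos_neg) linarith+
  finally show False using nonneg[of "x - t *\<^sub>R w"] by simp
qed

text \<open>For an eigenvector \<open>v\<close> the Hermitian form of \<open>S P S\<close> at \<open>v\<close> equals \<open>z\<close> times that of \<open>S\<close>. Both are real
  and nonnegative, so \<open>z\<close> is real and lies between \<open>0\<close> and \<open>t\<close> unless \<open>S v = 0\<close>, in which case
  \<open>z = 0\<close>. The computation is done in real and imaginary parts \<open>a\<close>, \<open>b\<close> of \<open>v\<close>.\<close>

lemma psd_product_eigenvalue_bound:
  assumes P: "psd P" and S: "psd S" and "0 \<le> t"
    and bound: "\<And>x. (S *v x) \<bullet> (P *v (S *v x)) \<le> t * (x \<bullet> (S *v x))"
    and z: "z \<in> eigenvalues (P ** S)"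
  shows "cmod z \<le> t"
proof -
  obtain v where "v \<noteq> 0" and v: "cmat (P ** S) *v v = z *s v"
    using z unfolding eigenvalues_def by blast
  define a b where "a = (\<chi> i. Re (v $ i))" and "b = (\<chi> i. Im (v $ i))"
  let ?\<alpha> = "Re z" and ?\<beta> = "Im z"
  have vi: "(\<Sum>j\<in>UNIV. complex_of_real ((P ** S) $ i $ j) * v $ j) = z * v $ i" for i
    using v by (simp add: vec_eq_iff matrix_vector_mult_def)
  have MS: "P *v (S *v x) = (P ** S) *v x" for x by (rule matrix_vector_mul_assoc)
  have Ma: "P *v (S *v a) = ?\<alpha> *\<^sub>R a - ?\<beta> *\<^sub>R b"
    using arg_cong[OF vi, of Re]
    unfolding MS by (simp add: vec_eq_iff a_def b_def matrix_vector_mult_def)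
  have Mb: "P *v (S *v b) = ?\<beta> *\<^sub>R a + ?\<alpha> *\<^sub>R b"
    using arg_cong[OF vi, of Im]
    unfolding MS by (simp add: vec_eq_iff a_def b_def matrix_vector_mult_def algebra_simps)
  have symP: "transpose P = P" and symS: "transpose S = S"
    and nonP: "\<And>y. 0 \<le> y \<bullet> (P *v y)" and nonS: "\<And>y. 0 \<le> y \<bullet> (S *v y)"
    using P S by (auto simp: psd_def)
  define q where "q = a \<bullet> (S *v a) + b \<bullet> (S *v b)"
  have Sab: "(S *v a) \<bullet> b = a \<bullet> (S *v b)" by (simp add: symmetric_inner[OF symS])
  have re: "(S *v a) \<bullet> (P *v (S *v a)) + (S *v b) \<bullet> (P *v (S *v b)) = ?\<alpha> * q"
    unfolding Ma Mb q_def using Sab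
    by (simp add: inner_add_right inner_diff_right inner_commute algebra_simps)
  have "(S *v a) \<bullet> (P *v (S *v b)) = (S *v b) \<bullet> (P *v (S *v a))"
    by (metis symmetric_inner[OF symP] inner_commute)
  then have im: "?\<beta> * q = 0"
    unfolding Ma Mb q_def using Sab
    by (simp add: inner_add_right inner_diff_right inner_commute algebra_simps)
  show ?thesis
  proof (cases "q = 0")
    case True
    then have "a \<bullet> (S *v a) = 0" "b \<bullet> (S *v b) = 0"
      using nonS[of a] nonS[of b] by (auto simp: q_def)
    then have "S *v a = 0" "S *v b = 0" using psd_kernel[OF S] by auto
    then have "z * v $ i = 0" for i
      using arg_cong[OF Ma, of "\<lambda>v. v $ i"] arg_cong[OF Mb, of "\<lambda>v. v $ i"]
      by (simp add: complex_eq_iff a_def b_def algebra_simps)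
    then have "z = 0" using \<open>v \<noteq> 0\<close> by (auto simp: vec_eq_iff)
    then show ?thesis using \<open>0 \<le> t\<close> by simp
  next
    case False
    then have "0 < q" using nonS[of a] nonS[of b] by (auto simp: q_def)
    then have "?\<beta> = 0" using im by simp
    have "0 \<le> ?\<alpha> * q" using re nonP[of "S *v a"] nonP[of "S *v b"] by simp
    moreover have "?\<alpha> * q \<le> t * q"
      using re bound[of a] bound[of b] by (simp add: q_def algebra_simps)
    ultimately have "0 \<le> ?\<alpha>" "?\<alpha> \<le> t" using \<open>0 < q\<close> by (auto simp: zero_le_mult_iff)
    then show ?thesis using \<open>?\<beta> = 0\<close> by (simp add: cmod_eq_Re)
  qed
qed

text \<open>The value \<open>s\<close> is the maximum of the generalized Rayleigh quotient of \<open>S P S\<close> relative to \<open>S\<close>. It is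
  attained because the quotient may be restricted to the unit sphere of the range of \<open>S\<close>, where its
  denominator does not vanish. A maximizer \<open>v\<^sub>0\<close> lies in the kernel of \<open>s S - S P S\<close>, which makes
  \<open>P S v\<^sub>0\<close> an eigenvector of \<open>P S\<close> for \<open>s\<close> when \<open>s > 0\<close>. When \<open>s = 0\<close>, the form of \<open>P\<close> vanishes at \<open>S v\<^sub>0\<close>,
  so \<open>v\<^sub>0\<close> itself is an eigenvector for \<open>0\<close>.\<close>

lemma psd_product_dominant_eigenvalue:
  fixes P S :: "real ^ 'n ^ 'n"
  assumes P: "psd P" and S: "psd S"
  obtains s where "0 \<le> s" and "complex_of_real s \<in> eigenvalues (P ** S)"
    and "\<And>x. (S *v x) \<bullet> (P *v (S *v x)) \<le> s * (x \<bullet> (S *v x))"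
proof (cases "S = 0")
  case True
  have "complex_of_real 0 \<in> eigenvalues (P ** S)"
    by (rule real_eigenvector[where x = "axis undefined 1"]) (auto simp: True axis_eq_0_iff)
  then show ?thesis using that[of 0] by (simp add: True)
next
  case False
  have symP: "transpose P = P" and symS: "transpose S = S"
    and nonP: "\<And>y. 0 \<le> y \<bullet> (P *v y)" and nonS: "\<And>y. 0 \<le> y \<bullet> (S *v y)"
    using P S by (auto simp: psd_def)
  define R where "R = range ((*v) S)"
  have sub: "subspace R"
    unfolding R_def by (rule linear_subspace_image) auto
  have pos: "0 < v \<bullet> (S *v v)" if "v \<in> R" "v \<noteq> 0" for v
  proof -
    obtain y where y: "v = S *v y" using \<open>v \<in> R\<close> by (auto simp: R_def)
    have "S *v v \<noteq> 0"
    proof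
      assume "S *v v = 0"
      then have "v \<bullet> v = 0" by (subst (2) y) (simp add: symmetric_inner[OF symS])
      with \<open>v \<noteq> 0\<close> show False by simp
    qed
    then show ?thesis using psd_kernel[OF S, of v] nonS[of v] by fastforce
  qed
  define K where "K = R \<inter> sphere 0 1"
  define f where "f v = ((S *v v) \<bullet> (P *v (S *v v))) / (v \<bullet> (S *v v))" for v
  have "compact K"
    unfolding K_def by (intro closed_Int_compact closed_subspace sub) auto
  moreover have "K \<noteq> {}"
  proof -
    obtain y where y: "S *v y \<noteq> 0" using False by (metis matrix_eq matrix_vector_mult_0)
    have "(1 / norm (S *v y)) *\<^sub>R (S *v y) \<in> K"
      unfolding K_def using y subspace_scale[OF sub, of "S *v y"] by (auto simp: R_def)
    then show ?thesis by blast
  qed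
  moreover have "continuous_on K f"
    unfolding f_def
    by (intro continuous_on_divide continuous_on_inner continuous_on_id
        linear_continuous_on[OF matrix_vector_mul_bounded_linear]
        continuous_on_compose2[OF linear_continuous_on[OF matrix_vector_mul_bounded_linear[of P], of UNIV]])
       (use pos in \<open>force simp: K_def\<close>)+
  ultimately obtain v0 where v0: "v0 \<in> K" and max: "\<And>v. v \<in> K \<Longrightarrow> f v \<le> f v0"
    using continuous_attains_sup by metis
  define s where "s = f v0"
  have "0 \<le> s" unfolding s_def f_def using nonP nonS by auto
  have "v0 \<noteq> 0" "v0 \<in> R" using v0 by (auto simp: K_def)
  have on_R: "(S *v r) \<bullet> (P *v (S *v r)) \<le> s * (r \<bullet> (S *v r))" if "r \<in> R" for r
  proof (cases "r = 0")
    case False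
    define c where "c = 1 / norm r"
    have "c \<noteq> 0" using False by (simp add: c_def)
    have "c *\<^sub>R r \<in> K"
      using False subspace_scale[OF sub that] by (auto simp: K_def c_def)
    then have "f (c *\<^sub>R r) \<le> s" unfolding s_def by (rule max)
    moreover have "f (c *\<^sub>R r) = f r"
      using \<open>c \<noteq> 0\<close> by (simp add: f_def matrix_vector_mult_scaleR)
    ultimately have "f r \<le> s" by simp
    then show ?thesis
      using pos[OF that False] by (simp add: f_def divide_le_eq)
  qed simp
  \<comment> \<open>Both forms ignore the component of \<open>x\<close> orthogonal to the range of \<open>S\<close>.\<close>
  have bound: "(S *v x) \<bullet> (P *v (S *v x)) \<le> s * (x \<bullet> (S *v x))" for x
  proof -
    obtain r n where r: "r \<in> span R" and n: "\<And>w. w \<in> span R \<Longrightarrow> orthogonal n w" and x: "x = r + n"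
      using orthogonal_subspace_decomp_exists by metis
    have "n \<bullet> (S *v (S *v n)) = 0"
      using n[of "S *v (S *v n)"] by (auto simp: orthogonal_def R_def intro: span_base)
    then have "(S *v n) \<bullet> (S *v n) = 0"
      using symmetric_inner[OF symS, of n "S *v n"] by simp
    then have "S *v n = 0" by simp
    then have Sx: "S *v x = S *v r" by (simp add: x matrix_vector_right_distrib)
    have "n \<bullet> (S *v r) = 0"
      using n[of "S *v r"] by (auto simp: orthogonal_def R_def intro: span_base)
    then have "x \<bullet> (S *v x) = r \<bullet> (S *v r)"
      unfolding Sx by (simp add: x inner_add_left)
    moreover have "r \<in> R" using r sub by (simp add: span_eq_iff[THEN iffD2])
    ultimately show ?thesis using on_R[of r] Sx by simp
  qed
  have "complex_of_real s \<in> eigenvalues (P ** S)"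
  proof (cases "s = 0")
    case True
    then have "(S *v v0) \<bullet> (P *v (S *v v0)) = 0"
      using bound[of v0] nonP[of "S *v v0"] by simp
    then have "P *v (S *v v0) = 0" by (rule psd_kernel[OF P])
    then show ?thesis
      using \<open>v0 \<noteq> 0\<close> by (intro real_eigenvector[of _ v0]) (simp_all add: matrix_vector_mul_assoc True)
  next
    case False
    define T where "T = s *\<^sub>R S - S ** P ** S"
    have T: "T *v x = s *\<^sub>R (S *v x) - S *v (P *v (S *v x))" for x
      by (simp add: T_def matrix_vector_mult_diff_rdistrib scaleR_matrix_vector_assoc
          matrix_vector_mul_assoc matrix_mul_assoc)
    have "psd T"
      unfolding psd_def
    proof
      show "transpose T = T"
        using symS symP
        by (simp add: T_def transpose_diff transpose_scalar matrix_transpose_mul matrix_mul_assoc)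
      show "\<forall>x. 0 \<le> x \<bullet> (T *v x)"
        using bound by (simp add: T inner_diff_right symmetric_inner[OF symS])
    qed
    moreover have "v0 \<bullet> (T *v v0) = 0"
      using pos[OF \<open>v0 \<in> R\<close> \<open>v0 \<noteq> 0\<close>]
      by (simp add: T inner_diff_right s_def f_def symmetric_inner[OF symS])
    ultimately have "T *v v0 = 0" by (rule psd_kernel)
    then have eq: "S *v (P *v (S *v v0)) = s *\<^sub>R (S *v v0)" by (simp add: T)
    show ?thesis
    proof (rule real_eigenvector[of _ "P *v (S *v v0)"])
      show "P ** S *v (P *v (S *v v0)) = s *\<^sub>R (P *v (S *v v0))"
        by (simp add: matrix_vector_mul_assoc[symmetric] eq matrix_vector_mult_scaleR)
      have "S *v v0 \<noteq> 0" using pos[OF \<open>v0 \<in> R\<close> \<open>v0 \<noteq> 0\<close>] by auto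
      then show "P *v (S *v v0) \<noteq> 0" using eq False by auto
    qed
  qed
  then show ?thesis using that \<open>0 \<le> s\<close> bound by blast
qed

text \<open>The dominant eigenvalue shows that the supremum in the spectral radius is an attained maximum.
  Together with \<open>psd_product_eigenvalue_bound\<close> this describes the spectral radius as the least
  \<open>t \<ge> 0\<close> with \<open>S P S \<le> t S\<close>, a condition that only becomes harder when \<open>P\<close> grows.\<close>

lemma spectral_radius_psd_product:
  assumes "psd P" "psd S"
  shows "complex_of_real (spectral_radius (P ** S)) \<in> eigenvalues (P ** S)"
    and "0 \<le> spectral_radius (P ** S)"
    and "(S *v x) \<bullet> (P *v (S *v x)) \<le> spectral_radius (P ** S) * (x \<bullet> (S *v x))"
    and "z \<in> eigenvalues (P ** S) \<Longrightarrow> cmod z \<le> spectral_radius (P ** S)"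
proof -
  obtain s where s: "0 \<le> s" "complex_of_real s \<in> eigenvalues (P ** S)"
    and bound: "\<And>x. (S *v x) \<bullet> (P *v (S *v x)) \<le> s * (x \<bullet> (S *v x))"
    using psd_product_dominant_eigenvalue[OF assms] by metis
  have le: "\<And>z. z \<in> eigenvalues (P ** S) \<Longrightarrow> cmod z \<le> s"
    using psd_product_eigenvalue_bound[OF assms s(1) bound] .
  have "spectral_radius (P ** S) = s"
    unfolding spectral_radius_def
    by (rule cSup_eq_maximum) (use s le in \<open>force simp: image_iff\<close>)+
  then show "complex_of_real (spectral_radius (P ** S)) \<in> eigenvalues (P ** S)"
    and "0 \<le> spectral_radius (P ** S)"
    and "(S *v x) \<bullet> (P *v (S *v x)) \<le> spectral_radius (P ** S) * (x \<bullet> (S *v x))"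
    and "z \<in> eigenvalues (P ** S) \<Longrightarrow> cmod z \<le> spectral_radius (P ** S)"
    using s bound le by auto
qed

lemma spectral_radius_psd_product_mono_left:
  assumes "psd P" "psd P'" "psd S" and "\<And>x. x \<bullet> (P *v x) \<le> x \<bullet> (P' *v x)"
  shows "spectral_radius (P ** S) \<le> spectral_radius (P' ** S)"
proof -
  have "cmod (complex_of_real (spectral_radius (P ** S))) \<le> spectral_radius (P' ** S)"
    by (rule psd_product_eigenvalue_bound[OF assms(1,3)])
       (use assms spectral_radius_psd_product in \<open>blast intro: order_trans\<close>)+
  then show ?thesis by simp
qed

lemma eigenvalues_product_commute:
  fixes P S :: "real ^ 'n ^ 'n"
  assumes "z \<in> eigenvalues (P ** S)" "z \<noteq> 0"
  shows "z \<in> eigenvalues (S ** P)"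
proof -
  obtain v where v: "v \<noteq> 0" "cmat P *v (cmat S *v v) = z *s v"
    using assms(1) by (auto simp: eigenvalues_def cmat_mult matrix_vector_mul_assoc)
  then have "cmat S *v v \<noteq> 0" using assms(2) by auto
  moreover have "cmat (S ** P) *v (cmat S *v v) = z *s (cmat S *v v)"
    using v(2) by (simp only: cmat_mult matrix_vector_mul_assoc[symmetric] vec.scale)
  ultimately show ?thesis unfolding eigenvalues_def by blast
qed

lemma spectral_radius_psd_product_commute:
  assumes "psd P" "psd S"
  shows "spectral_radius (P ** S) = spectral_radius (S ** P)"
proof -
  have "spectral_radius (P ** S) \<le> spectral_radius (S ** P)" if "psd P" "psd S"
    for P S :: "real ^ 'n ^ 'n"
  proof (cases "spectral_radius (P ** S) = 0")
    case True
    then show ?thesis using spectral_radius_psd_product(2) that by metis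
  next
    case False
    then have "complex_of_real (spectral_radius (P ** S)) \<in> eigenvalues (S ** P)"
      using eigenvalues_product_commute spectral_radius_psd_product(1)[OF that] by fastforce
    from spectral_radius_psd_product(4)[OF that(2,1) this] show ?thesis by simp
  qed
  then show ?thesis using assms by (intro antisym) auto
qed

text \<open>The two factors are enlarged one after the other, the second one after commuting it to the
  left.\<close>

lemma spectral_radius_psd_product_mono:
  assumes "psd P" "psd P'" "psd S" "psd S'"
    and "\<And>x. x \<bullet> (P *v x) \<le> x \<bullet> (P' *v x)" "\<And>x. x \<bullet> (S *v x) \<le> x \<bullet> (S' *v x)"
  shows "spectral_radius (P ** S) \<le> spectral_radius (P' ** S')"
proof -
  have "spectral_radius (P ** S) \<le> spectral_radius (P' ** S)"
    using assms by (intro spectral_radius_psd_product_mono_left)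
  also have "\<dots> = spectral_radius (S ** P')"
    using assms by (intro spectral_radius_psd_product_commute)
  also have "\<dots> \<le> spectral_radius (S' ** P')"
    using assms by (intro spectral_radius_psd_product_mono_left)
  also have "\<dots> = spectral_radius (P' ** S')"
    using assms by (intro spectral_radius_psd_product_commute)
  finally show ?thesis .
qed

section \<open>Coefficients that depend on the attenuation level\<close>

lemma gram_difference_quadratic_form:
  fixes L :: "real ^ 'n ^ 'q" and K :: "real ^ 'n ^ 'k"
  shows "x \<bullet> ((transpose L ** L - c *\<^sub>R (transpose K ** K)) *v x)
    = (norm (L *v x))\<^sup>2 - c * (norm (K *v x))\<^sup>2"
  by (simp add: matrix_vector_mult_diff_rdistrib scaleR_matrix_vector_assoc[symmetric]
      matrix_vector_mul_assoc[symmetric] inner_diff_right inner_transpose power2_norm_eq_inner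
      del: transpose_matrix_vector)

text \<open>Both Riccati equations have this shape: the coefficient is \<open>L\<^sup>T L - \<gamma>\<^sup>-\<^sup>2 K\<^sup>T K\<close>, which increases
  with \<open>\<gamma>\<close>. The bound on \<open>K x\<close> says that it is positive semidefinite at \<open>\<gamma> = g\<close>.\<close>

lemma riccati_gram_antimono:
  fixes L :: "real ^ 'n ^ 'q" and K :: "real ^ 'n ^ 'k"
  assumes contr: "\<And>x. norm (K *v x) \<le> g * norm (L *v x)"
    and g: "0 < g" "g \<le> h"
    and Xg: "stabilizing_riccati_solution A (transpose L ** L - (1 / g\<^sup>2) *\<^sub>R (transpose K ** K)) Q Xg"
    and Xh: "stabilizing_riccati_solution A (transpose L ** L - (1 / h\<^sup>2) *\<^sub>R (transpose K ** K)) Q Xh"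
  shows "x \<bullet> (Xh *v x) \<le> x \<bullet> (Xg *v x)"
proof (rule riccati_antimono[OF Xg Xh])
  show "transpose (transpose L ** L - (1 / g\<^sup>2) *\<^sub>R (transpose K ** K))
      = transpose L ** L - (1 / g\<^sup>2) *\<^sub>R (transpose K ** K)"
    by (simp add: transpose_diff transpose_scalar matrix_transpose_mul)
  fix x
  have "(norm (K *v x))\<^sup>2 \<le> (g * norm (L *v x))\<^sup>2"
    by (rule power_mono[OF contr]) simp
  then show "0 \<le> x \<bullet> ((transpose L ** L - (1 / g\<^sup>2) *\<^sub>R (transpose K ** K)) *v x)"
    unfolding gram_difference_quadratic_form using g(1) by (simp add: field_simps)
  have "1 / h\<^sup>2 \<le> 1 / g\<^sup>2"
    using g by (intro divide_left_mono power_mono) auto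
  then show "x \<bullet> ((transpose L ** L - (1 / g\<^sup>2) *\<^sub>R (transpose K ** K)) *v x)
      \<le> x \<bullet> ((transpose L ** L - (1 / h\<^sup>2) *\<^sub>R (transpose K ** K)) *v x)"
    unfolding gram_difference_quadratic_form
    by (intro diff_left_mono mult_right_mono) auto
qed

lemma norm_mult_le_spectral_norm: "norm (W *v u) \<le> spectral_norm W * norm u"
  unfolding spectral_norm_def by (rule onorm[OF matrix_vector_mul_bounded_linear])

lemma norm_transpose_mult_le_spectral_norm: "norm (transpose W *v u) \<le> spectral_norm W * norm u"
proof (cases "transpose W *v u = 0")
  case True
  have "0 \<le> spectral_norm W"
    unfolding spectral_norm_def by (rule onorm_pos_le[OF matrix_vector_mul_bounded_linear])
  then show ?thesis unfolding True by simp
next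
  case False
  let ?w = "transpose W *v u"
  have "norm ?w * norm ?w = ?w \<bullet> ?w"
    by (simp add: power2_norm_eq_inner[symmetric] power2_eq_square)
  also have "\<dots> = (W *v ?w) \<bullet> u" by (rule inner_transpose)
  also have "\<dots> \<le> norm (W *v ?w) * norm u" by (rule norm_cauchy_schwarz)
  also have "\<dots> \<le> spectral_norm W * norm ?w * norm u"
    by (intro mult_right_mono norm_mult_le_spectral_norm) auto
  finally have "norm ?w * norm ?w \<le> norm ?w * (spectral_norm W * norm u)"
    by (simp add: mult_ac)
  then show ?thesis using False by (simp del: transpose_matrix_vector)
qed

section \<open>Monotonicity and decay of the coupling ratio\<close>

theorem proposition3p3:
  fixes A :: "real ^ 'n ^ 'n"
    and B1o :: "real ^ 'm1 ^ 'n" and B2 :: "real ^ 'm2 ^ 'n"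
    and C1o :: "real ^ 'n ^ 'p1" and C2 :: "real ^ 'n ^ 'p2"
    and X Y :: "real \<Rightarrow> real ^ 'n ^ 'n"
  assumes "gamma_star B1o B2 C1o C2 > 0"
    and "stabilizable A B2" and "stabilizable A (B1_tilde B1o B2)"
    and "detectable (C1_tilde C1o C2) A" and "detectable C2 A"
    and "\<And>\<gamma>. \<gamma> > gamma_star B1o B2 C1o C2 \<Longrightarrow>
           stabilizing_riccati_solution A (G_mat B1o B2 \<gamma>)
             (transpose (C1_tilde C1o C2) ** C1_tilde C1o C2) (X \<gamma>) \<and> psd (X \<gamma>)"
    and "\<And>\<gamma>. \<gamma> > gamma_star B1o B2 C1o C2 \<Longrightarrow>
           stabilizing_riccati_solution (transpose A) (H_mat C1o C2 \<gamma>)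
             (B1_tilde B1o B2 ** transpose (B1_tilde B1o B2)) (Y \<gamma>) \<and> psd (Y \<gamma>)"
  shows "antimono_on {gamma_star B1o B2 C1o C2<..} (chi X Y)
    \<and> (chi X Y \<longlongrightarrow> 0) at_top
    \<and> (\<forall>\<gamma>\<^sub>l > gamma_star B1o B2 C1o C2. \<forall>\<tau> \<eta>. 0 < \<tau> \<and> \<tau> < 1 \<and> \<eta> > 0 \<longrightarrow>
         chi X Y ((1 + \<eta>) * max \<gamma>\<^sub>l (sqrt (rho X Y \<gamma>\<^sub>l / (1 - \<tau>)))) < 1 - \<tau>)"
proof (intro conjI allI impI)
  let ?\<gamma>s = "gamma_star B1o B2 C1o C2"
  let ?W = "moore_penrose B2 ** B1o" and ?V = "C1o ** moore_penrose C2"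
  have psdX: "psd (X \<gamma>)" and psdY: "psd (Y \<gamma>)" if "?\<gamma>s < \<gamma>" for \<gamma>
    using assms(6,7)[OF that] by auto
  have W: "spectral_norm ?W \<le> ?\<gamma>s" and V: "spectral_norm ?V \<le> ?\<gamma>s"
    by (simp_all add: gamma_star_def)
  have X_le: "x \<bullet> (X h *v x) \<le> x \<bullet> (X g *v x)" if "?\<gamma>s < g" "g \<le> h" for g h x
  proof (rule riccati_gram_antimono[where A = A and L = "transpose B2"
        and Q = "transpose (C1_tilde C1o C2) ** C1_tilde C1o C2" and K = "transpose (B1_tilde B1o B2)"])
    fix x
    have "transpose (B1_tilde B1o B2) *v x = transpose ?W *v (transpose B2 *v x)"
      by (simp only: B1_tilde_def matrix_transpose_mul matrix_vector_mul_assoc matrix_mul_assoc)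
    then have "norm (transpose (B1_tilde B1o B2) *v x) \<le> spectral_norm ?W * norm (transpose B2 *v x)"
      by (simp only: norm_transpose_mult_le_spectral_norm)
    also have "\<dots> \<le> g * norm (transpose B2 *v x)"
      using W that(1) by (intro mult_right_mono) auto
    finally show "norm (transpose (B1_tilde B1o B2) *v x) \<le> g * norm (transpose B2 *v x)" .
  next
    show "0 < g" "g \<le> h" using that assms(1) by auto
  qed (use assms(6)[of g] assms(6)[of h] that in \<open>simp_all add: G_mat_def\<close>)
  have Y_le: "x \<bullet> (Y h *v x) \<le> x \<bullet> (Y g *v x)" if "?\<gamma>s < g" "g \<le> h" for g h x
  proof (rule riccati_gram_antimono[where A = "transpose A" and L = C2
        and Q = "B1_tilde B1o B2 ** transpose (B1_tilde B1o B2)" and K = "C1_tilde C1o C2"])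
    fix x
    have "C1_tilde C1o C2 *v x = ?V *v (C2 *v x)"
      by (simp only: C1_tilde_def matrix_vector_mul_assoc)
    then have "norm (C1_tilde C1o C2 *v x) \<le> spectral_norm ?V * norm (C2 *v x)"
      by (simp only: norm_mult_le_spectral_norm)
    also have "\<dots> \<le> g * norm (C2 *v x)"
      using V that(1) by (intro mult_right_mono) auto
    finally show "norm (C1_tilde C1o C2 *v x) \<le> g * norm (C2 *v x)" .
  next
    show "0 < g" "g \<le> h" using that assms(1) by auto
  qed (use assms(7)[of g] assms(7)[of h] that in \<open>simp_all add: H_mat_def\<close>)
  have rho_le: "rho X Y h \<le> rho X Y g" if "?\<gamma>s < g" "g \<le> h" for g h
    unfolding rho_def
    using that by (intro spectral_radius_psd_product_mono psdX psdY X_le Y_le) auto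
  have rho_nonneg: "0 \<le> rho X Y g" if "?\<gamma>s < g" for g
    unfolding rho_def using that by (intro spectral_radius_psd_product(2) psdX psdY)
  show "antimono_on {?\<gamma>s<..} (chi X Y)"
  proof (rule monotone_onI)
    fix g h assume "g \<in> {?\<gamma>s<..}" "h \<in> {?\<gamma>s<..}" "g \<le> h"
    then show "chi X Y h \<le> chi X Y g"
      unfolding chi_def using assms(1) rho_nonneg rho_le
      by (intro frac_le power_mono zero_less_power) auto
  qed
  show "(chi X Y \<longlongrightarrow> 0) at_top"
  proof (rule tendsto_sandwich)
    let ?g = "?\<gamma>s + 1"
    show "\<forall>\<^sub>F h in at_top. 0 \<le> chi X Y h"
      using eventually_gt_at_top[of ?\<gamma>s]
      by eventually_elim (simp add: chi_def rho_nonneg)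
    show "\<forall>\<^sub>F h in at_top. chi X Y h \<le> rho X Y ?g / h\<^sup>2"
      using eventually_ge_at_top[of ?g]
      by eventually_elim (auto simp: chi_def intro!: divide_right_mono rho_le)
    show "((\<lambda>h. rho X Y ?g / h\<^sup>2) \<longlongrightarrow> 0) at_top"
      by (intro tendsto_divide_0[OF tendsto_const] filterlim_at_top_imp_at_infinity
          filterlim_pow_at_top filterlim_ident) simp
  qed simp
  fix \<gamma>\<^sub>l \<tau> \<eta> :: real
  assume \<gamma>: "?\<gamma>s < \<gamma>\<^sub>l" and "0 < \<tau> \<and> \<tau> < 1 \<and> \<eta> > 0"
  then have \<tau>: "0 < 1 - \<tau>" and \<eta>: "0 < \<eta>" by auto
  define m where "m = max \<gamma>\<^sub>l (sqrt (rho X Y \<gamma>\<^sub>l / (1 - \<tau>)))"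
  define g where "g = (1 + \<eta>) * m"
  have "0 < m" using \<gamma> assms(1) by (simp add: m_def)
  \<comment> \<open>The factor \<open>1 + \<eta>\<close> makes the final inequality strict.\<close>
  then have "m < g" using \<eta> by (simp add: g_def algebra_simps)
  then have "\<gamma>\<^sub>l \<le> g" and "sqrt (rho X Y \<gamma>\<^sub>l / (1 - \<tau>)) < g" by (auto simp: m_def)
  then have "(sqrt (rho X Y \<gamma>\<^sub>l / (1 - \<tau>)))\<^sup>2 < g\<^sup>2"
    using rho_nonneg[OF \<gamma>] \<tau> by (intro power_strict_mono) auto
  then have "rho X Y \<gamma>\<^sub>l < (1 - \<tau>) * g\<^sup>2"
    using rho_nonneg[OF \<gamma>] \<tau> by (simp add: divide_less_eq mult.commute)
  then have "rho X Y g < (1 - \<tau>) * g\<^sup>2"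
    using rho_le[OF \<gamma> \<open>\<gamma>\<^sub>l \<le> g\<close>] by simp
  then have "chi X Y g < 1 - \<tau>"
    using \<open>0 < m\<close> \<open>m < g\<close> by (simp add: chi_def divide_less_eq)
  then show "chi X Y ((1 + \<eta>) * max \<gamma>\<^sub>l (sqrt (rho X Y \<gamma>\<^sub>l / (1 - \<tau>)))) < 1 - \<tau>"
    by (simp add: g_def m_def)
qed

end
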